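(* Let $F=(f_1,\ldots,f_k):\mathbb{R}^n\to\mathbb{R}^k$, $k\le n$, be a real polynomial mapping with $F(0)=0$ such that $f_i$ is convenient for all $i=1,\ldots,k$. If $F$ satisfies condition (BA), then $F$ satisfies condition (ND). Moreover, if $k=n$, then conditions (BA) and (ND) are equivalent for $F$.
   Context: **Supports, convenience, Newton polyhedra.** For a real polynomial $f(x)=\sum_\nu c_\nu x^\nu$ with $f(0)=0$, put $\operatorname{supp}(f)=\{\nu\in\mathbb{N}^n: c_\nu\ne0\}$. $f$ is *convenient* if $\operatorname{supp}(f)$ meets every coordinate axis. $\Gamma_0(f)$ is the convex hull of $\{0\}\cup\operatorname{supp}(f)$. For a face $\Delta$ (of any dimension), $f_\Delta=\sum_{\nu\in\Delta\cap\operatorname{supp}(f)}c_\nu x^\nu$. $\mathbb{R}^*=\mathbb{R}\setminus\{0\}$, and $\operatorname{Sing}$ of a map denotes the set of points where its differential is not surjective. **Faces defined by vectors.** For $\mathbf{p}=(p_1,\ldots,p_n)\in\mathbb{Z}^n$ with $\min_i p_i<0$, let $l_{\mathbf{p}}(v)=\sum_i p_iv_i$ and let $\Delta^j_{\mathbf{p}}$ be the maximal face of $\Gamma_0(f_j)$ on which $l_{\mathbf{p}}$ attains its minimum over $\Gamma_0(f_j)$; $f_{\Delta^j_{\mathbf{p}}}$ stands for $(f_j)_{\Delta^j_{\mathbf{p}}}$. **Condition (BA)** (non-degeneracy at infinity in the sense of Bivià-Ausina): for every $\mathbf{p}\in\mathbb{Z}^n$ with $\min_i p_i<0$, $$\{x\in(\mathbb{R}^*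 )^n: f_{\Delta^j_{\mathbf{p}}}(x)=0\ \text{for all } j=1,\ldots,k\}=\emptyset.$$ **Condition (ND)** (non-degeneracy at infinity in the sense of the paper): Declare $\mathbf{p}\sim\mathbf{p}'$ iff $\Delta^j_{\mathbf{p}}=\Delta^j_{\mathbf{p}'}$ for all $1\le j\le k$. The equivalence classes give a partition of $\mathbb{R}^n\setminus\mathbb{R}^n_+$ (where $\mathbb{R}_+^n$ is the set of vectors with all coordinates $\ge 0$) into finitely many locally closed cones; each is subdivided into finitely many convex polyhedral cones, and $\mathcal{C}(F)$ is the finite set of cones obtained. For $\sigma\in\mathcal{C}(F)$, write $\Delta^j_\sigma:=\Delta^j_{\mathbf{p}}$ for any $\mathbf{p}\in\sigma$ (independent of $\mathbf{p}$), $I_\sigma=\{j: 0\notin\Delta^j_\sigma\}$, $J_\sigma=\{j:\Delta^j_\sigma=\{0\}\}$, and $G_\sigma=\{x\in(\mathbb{R}^* )^n: f_{\Delta^j_\sigma}(x)=0\ \text{for all } j\in I_\sigma\}$. Then (ND) requires that for every $\sigma\in\mathcal{C}(F)$ with $I_\sigma\ne\emptyset$ and $J_\sigma=\emptyset$, one has $\operatorname{Sing}\,(f_{\Delta^j_\sigma})_{j\in I_\sigma}\cap G_\sigma=\emptyset$. *)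

theory Defs
  imports
    "HOL-Analysis.Analysis"
    "HOL-Library.Poly_Mapping"
    "HOL-Library.Disjoint_Sets"
begin

text \<open>
  A real polynomial in the variables indexed by \<open>'n\<close> is a finitely supported function
  \<open>(nat ^ 'n) \<Rightarrow>\<^sub>0 real\<close> from exponent vectors to coefficients, so that \<open>Poly_Mapping.keys f\<close>
  is \<open>supp f\<close>.
\<close>

type_synonym 'n rpoly = "(nat ^ 'n) \<Rightarrow>\<^sub>0 real"

definition poly_eval :: "'n::finite rpoly \<Rightarrow> real ^ 'n \<Rightarrow> real" where
  "poly_eval f x =
     (\<Sum>\<nu>\<in>Poly_Mapping.keys f. Poly_Mapping.lookup f \<nu> * (\<Prod>i\<in>UNIV. x $ i ^ (\<nu> $ i)))"

definition real_vec :: "nat ^ 'n \<Rightarrow> real ^ 'n" where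
  "real_vec \<nu> = (\<chi> i. real (\<nu> $ i))"

definition int_vec :: "int ^ 'n \<Rightarrow> real ^ 'n" where
  "int_vec p = (\<chi> i. real_of_int (p $ i))"

text \<open>
  If \<open>f(0) = 0\<close> then \<open>0 \<notin> supp f\<close>, so the exponents \<open>m\<close> below are automatically positive.
\<close>

definition convenient :: "'n::finite rpoly \<Rightarrow> bool" where
  "convenient f \<longleftrightarrow> (\<forall>i. \<exists>m. axis i m \<in> Poly_Mapping.keys f)"

definition newton_polyhedron :: "'n::finite rpoly \<Rightarrow> (real ^ 'n) set" where
  "newton_polyhedron f = convex hull (insert 0 (real_vec ` Poly_Mapping.keys f))"

definition face_part :: "(real ^ 'n) set \<Rightarrow> 'n::finite rpoly \<Rightarrow> 'n rpoly" where
  "face_part \<Delta> f = (\<Sum>\<nu> | \<nu> \<in> Poly_Mapping.keys f \<and> real_vec \<nu> \<in> \<Delta>.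
     Poly_Mapping.single \<nu> (Poly_Mapping.lookup f \<nu>))"

text \<open>
  The face \<open>\<Delta>\<^sub>p\<close>. The vector \<open>p\<close> is allowed to be real, and \<open>l\<^sub>p v = p \<bullet> v\<close>; lemma
  \<open>min_face_maximal\<close> shows that this is the maximal face on which \<open>l\<^sub>p\<close> attains its minimum.
\<close>

definition min_face :: "real ^ 'n \<Rightarrow> 'n::finite rpoly \<Rightarrow> (real ^ 'n) set" where
  "min_face p f =
     {v \<in> newton_polyhedron f. \<forall>w\<in>newton_polyhedron f. p \<bullet> v \<le> p \<bullet> w}"

definition torus :: "(real ^ 'n) set" where
  "torus = {x. \<forall>i. x $ i \<noteq> 0}"

definition BA :: "('k::finite \<Rightarrow> 'n::finite rpoly) \<Rightarrow> bool" where
  "BA F \<longleftrightarrow> (\<forall>p :: int ^ 'n. Min (range (\<lambda>i. p $ i)) < 0 \<longrightarrow>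
     {x \<in> torus. \<forall>j. poly_eval (face_part (min_face (int_vec p) (F j)) (F j)) x = 0} = {})"

text \<open>The complement of the closed orthant \<open>\<real>\<^sub>+\<^sup>n\<close>.\<close>

definition non_orthant :: "(real ^ 'n) set" where
  "non_orthant = UNIV - {p. \<forall>i. 0 \<le> p $ i}"

definition same_faces :: "('k::finite \<Rightarrow> 'n::finite rpoly) \<Rightarrow> ((real ^ 'n) \<times> (real ^ 'n)) set" where
  "same_faces F = {(p, q). p \<in> non_orthant \<and> q \<in> non_orthant \<and>
     (\<forall>j. min_face p (F j) = min_face q (F j))}"

text \<open>
  Convex polyhedral cones are not assumed to be closed: the cones that partition the complement
  of the orthant cannot contain the origin.
\<close>

definition convex_polyhedral_cone :: "(real ^ 'n) set \<Rightarrow> bool" where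
  "convex_polyhedral_cone \<sigma> \<longleftrightarrow> (\<exists>A B. finite A \<and> finite B \<and>
     \<sigma> = {p. (\<forall>a\<in>A. 0 \<le> a \<bullet> p) \<and> (\<forall>b\<in>B. 0 < b \<bullet> p)})"

text \<open>
  \<open>C\<close> is a possible choice of \<open>\<C>(F)\<close>: a finite partition into (nonempty) convex polyhedral
  cones which subdivides the partition into equivalence classes. Such a choice exists by lemma
  \<open>ex_cone_subdivision\<close>.
\<close>

definition cone_subdivision ::
    "('k::finite \<Rightarrow> 'n::finite rpoly) \<Rightarrow> (real ^ 'n) set set \<Rightarrow> bool" where
  "cone_subdivision F C \<longleftrightarrow>
     finite C \<and> partition_on non_orthant C \<and>
     (\<forall>\<sigma>\<in>C. convex_polyhedral_cone \<sigma> \<and> (\<exists>E \<in> non_orthant // same_faces F. \<sigma> \<subseteq> E))"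

definition cone_face :: "(real ^ 'n) set \<Rightarrow> 'n::finite rpoly \<Rightarrow> (real ^ 'n) set" where
  "cone_face \<sigma> f = min_face (SOME p. p \<in> \<sigma>) f"

definition I_set :: "('k::finite \<Rightarrow> 'n::finite rpoly) \<Rightarrow> (real ^ 'n) set \<Rightarrow> 'k set" where
  "I_set F \<sigma> = {j. 0 \<notin> cone_face \<sigma> (F j)}"

definition J_set :: "('k::finite \<Rightarrow> 'n::finite rpoly) \<Rightarrow> (real ^ 'n) set \<Rightarrow> 'k set" where
  "J_set F \<sigma> = {j. cone_face \<sigma> (F j) = {0}}"

definition G_set :: "('k::finite \<Rightarrow> 'n::finite rpoly) \<Rightarrow> (real ^ 'n) set \<Rightarrow> (real ^ 'n) set" where
  "G_set F \<sigma> =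
     {x \<in> torus. \<forall>j\<in>I_set F \<sigma>. poly_eval (face_part (cone_face \<sigma> (F j)) (F j)) x = 0}"

text \<open>
  For a family \<open>g\<close> and \<open>I \<subseteq> UNIV\<close>, the map \<open>(g\<^sub>j)\<^bsub>j \<in> I\<^esub> : \<real>\<^sup>n \<rightarrow> \<real>\<^sup>I\<close> is treated as a map into
  the coordinate subspace of \<open>real ^ 'k\<close> spanned by the axes in \<open>I\<close>.
\<close>

definition subfamily_map :: "'k set \<Rightarrow> ('k::finite \<Rightarrow> real ^ 'n \<Rightarrow> real) \<Rightarrow> real ^ 'n \<Rightarrow> real ^ 'k" where
  "subfamily_map I g x = (\<chi> j. if j \<in> I then g j x else 0)"

definition Sing :: "'k set \<Rightarrow> ('k::finite \<Rightarrow> real ^ 'n::finite \<Rightarrow> real) \<Rightarrow> (real ^ 'n) set" where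
  "Sing I g = {x. range (frechet_derivative (subfamily_map I g) (at x)) \<noteq>
     {y. \<forall>j. j \<notin> I \<longrightarrow> y $ j = 0}}"

definition ND :: "('k::finite \<Rightarrow> 'n::finite rpoly) \<Rightarrow> (real ^ 'n) set set \<Rightarrow> bool" where
  "ND F C \<longleftrightarrow> (\<forall>\<sigma>\<in>C. I_set F \<sigma> \<noteq> {} \<and> J_set F \<sigma> = {} \<longrightarrow>
     Sing (I_set F \<sigma>) (\<lambda>j. poly_eval (face_part (cone_face \<sigma> (F j)) (F j))) \<inter> G_set F \<sigma> = {})"

lemma min_face_maximal:
  fixes p :: "real ^ 'n::finite"
  shows "min_face p f face_of newton_polyhedron f"
    and "min_face p f \<noteq> {}"
    and "T \<subseteq> newton_polyhedron f \<Longrightarrow>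
      (\<And>v w. v \<in> T \<Longrightarrow> w \<in> newton_polyhedron f \<Longrightarrow> p \<bullet> v \<le> p \<bullet> w) \<Longrightarrow> T \<subseteq> min_face p f"
proof -
  let ?G = "newton_polyhedron f"
  have "compact ?G" "?G \<noteq> {}" "convex ?G"
    unfolding newton_polyhedron_def
    by (auto intro!: finite_imp_compact_convex_hull)
  moreover have "continuous_on ?G (\<lambda>v. p \<bullet> v)" by (intro continuous_intros)
  ultimately obtain v0 where v0: "v0 \<in> ?G" "\<And>w. w \<in> ?G \<Longrightarrow> p \<bullet> v0 \<le> p \<bullet> w"
    using continuous_attains_inf by metis
  then show "min_face p f \<noteq> {}" by (auto simp: min_face_def)
  have eq: "min_face p f = ?G \<inter> {v. p \<bullet> v = p \<bullet> v0}"
    using v0 by (force simp: min_face_def)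
  show "min_face p f face_of ?G"
    unfolding eq using \<open>convex ?G\<close> v0(2) by (rule face_of_Int_supporting_hyperplane_ge)
  show "T \<subseteq> min_face p f" if "T \<subseteq> ?G" "\<And>v w. v \<in> T \<Longrightarrow> w \<in> ?G \<Longrightarrow> p \<bullet> v \<le> p \<bullet> w"
    using that by (auto simp: min_face_def)
qed

lemma equiv_same_faces: "equiv non_orthant (same_faces F)"
  by (rule equivI) (auto simp: same_faces_def refl_on_def sym_def trans_def)

lemma cone_face_eq:
  assumes "cone_subdivision F C" "\<sigma> \<in> C" "p \<in> \<sigma>"
  shows "cone_face \<sigma> (F j) = min_face p (F j)"
proof -
  obtain E where E: "E \<in> non_orthant // same_faces F" "\<sigma> \<subseteq> E"
    using assms by (auto simp: cone_subdivision_def)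
  have "(SOME p. p \<in> \<sigma>) \<in> \<sigma>" using assms(3) by (rule someI)
  then have "((SOME p. p \<in> \<sigma>), p) \<in> same_faces F"
    using E assms(3) equiv_same_faces
    by (meson quotient_eq_iff subset_iff)
  then show ?thesis by (auto simp: same_faces_def cone_face_def)
qed

lemma min_face_subset_of_sgn:
  fixes p q :: "real ^ 'n::finite"
  defines "S \<equiv> \<lambda>f :: 'n rpoly. insert 0 (real_vec ` Poly_Mapping.keys f)"
  assumes sg: "\<And>v w. v \<in> S f \<Longrightarrow> w \<in> S f \<Longrightarrow> sgn ((v - w) \<bullet> p) = sgn ((v - w) \<bullet> q)"
  shows "min_face p f \<subseteq> min_face q f"
proof
  fix v assume v: "v \<in> min_face p f"
  have fin: "finite (S f)" and ne: "S f \<noteq> {}" by (auto simp: S_def)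
  have hull: "newton_polyhedron f = convex hull (S f)"
    by (simp add: newton_polyhedron_def S_def)
  obtain s0 where s0: "s0 \<in> S f" "\<And>s. s \<in> S f \<Longrightarrow> p \<bullet> s0 \<le> p \<bullet> s"
    using ex_min_if_finite[of "(\<lambda>s. p \<bullet> s) ` S f"] fin ne by (force simp: not_less)
  have q0: "q \<bullet> s0 \<le> q \<bullet> s" if "s \<in> S f" for s
  proof -
    have "0 \<le> sgn ((s - s0) \<bullet> p)" using s0(2)[OF that] by (simp add: inner_simps inner_commute)
    then have "0 \<le> sgn ((s - s0) \<bullet> q)" using sg[OF that s0(1)] by simp
    then show ?thesis by (simp add: inner_simps inner_commute)
  qed
  have qeq: "q \<bullet> s = q \<bullet> s0" if "s \<in> S f" "p \<bullet> s = p \<bullet> s0" for s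
  proof -
    have "sgn ((s - s0) \<bullet> p) = 0" using that(2) by (simp add: inner_simps inner_commute)
    then have "sgn ((s - s0) \<bullet> q) = 0" using sg[OF that(1) s0(1)] by simp
    then show ?thesis by (simp add: sgn_0_0 inner_simps inner_commute)
  qed
  have "v \<in> convex hull (S f)" using v by (simp add: min_face_def hull)
  then obtain u where u: "\<And>s. s \<in> S f \<Longrightarrow> 0 \<le> u s" "sum u (S f) = 1"
      "(\<Sum>s\<in>S f. u s *\<^sub>R s) = v"
    unfolding convex_hull_finite[OF fin] by auto
  have split: "r \<bullet> v - r \<bullet> s0 = (\<Sum>s\<in>S f. u s * (r \<bullet> s - r \<bullet> s0))" for r
    using u(2) by (simp add: u(3)[symmetric] inner_sum_right right_diff_distrib
        sum_subtractf flip: sum_distrib_right)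
  have "s0 \<in> newton_polyhedron f" using s0(1) by (simp add: hull hull_inc)
  then have "p \<bullet> v \<le> p \<bullet> s0" using v by (auto simp: min_face_def)
  moreover have nn: "\<And>s. s \<in> S f \<Longrightarrow> 0 \<le> u s * (p \<bullet> s - p \<bullet> s0)"
    using u(1) s0(2) by simp
  ultimately have "(\<Sum>s\<in>S f. u s * (p \<bullet> s - p \<bullet> s0)) = 0"
    using split[of p] sum_nonneg[of "S f" "\<lambda>s. u s * (p \<bullet> s - p \<bullet> s0)", OF nn] by linarith
  then have "\<forall>s\<in>S f. u s * (p \<bullet> s - p \<bullet> s0) = 0"
    using sum_nonneg_eq_0_iff[OF fin, of "\<lambda>s. u s * (p \<bullet> s - p \<bullet> s0)"] nn by blast
  then have "\<forall>s\<in>S f. u s * (q \<bullet> s - q \<bullet> s0) = 0" using qeq by auto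
  then have "(\<Sum>s\<in>S f. u s * (q \<bullet> s - q \<bullet> s0)) = 0" by (intro sum.neutral)
  then have qv: "q \<bullet> v = q \<bullet> s0" using split[of q] by linarith
  have "convex hull (S f) \<subseteq> {w. q \<bullet> s0 \<le> q \<bullet> w}"
    using q0 by (intro hull_minimal) (auto simp: convex_halfspace_ge)
  then show "v \<in> min_face q f"
    using v qv by (auto simp: min_face_def hull)
qed

lemma ex_cone_subdivision:
  fixes F :: "'k::finite \<Rightarrow> 'n::finite rpoly"
  shows "\<exists>C. cone_subdivision F C"
proof -
  define S where "S = (\<lambda>f :: 'n rpoly. insert 0 (real_vec ` Poly_Mapping.keys f))"
  define D where "D = (\<Union>j. (\<lambda>(v, w). v - w) ` (S (F j) \<times> S (F j))) \<union> range (\<lambda>i. axis i (1::real))"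
  define cell where "cell = (\<lambda>p. {q. \<forall>d\<in>D. sgn (d \<bullet> q) = sgn (d \<bullet> p)})"
  define C where "C = cell ` non_orthant"
  have finD: "finite D" by (auto simp: D_def S_def)
  have "C \<subseteq> (\<lambda>s. {q. \<forall>d\<in>D. sgn (d \<bullet> q) = s d}) ` (D \<rightarrow>\<^sub>E {-1, 0, 1})"
  proof
    fix \<sigma> assume "\<sigma> \<in> C"
    then obtain p where "\<sigma> = cell p" by (auto simp: C_def)
    then have "\<sigma> = {q. \<forall>d\<in>D. sgn (d \<bullet> q) = restrict (\<lambda>d. sgn (d \<bullet> p)) D d}"
      by (auto simp: cell_def)
    moreover have "restrict (\<lambda>d. sgn (d \<bullet> p)) D \<in> D \<rightarrow>\<^sub>E {-1, 0, 1}"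
      by (auto simp: sgn_real_def)
    ultimately show "\<sigma> \<in> (\<lambda>s. {q. \<forall>d\<in>D. sgn (d \<bullet> q) = s d}) ` (D \<rightarrow>\<^sub>E {-1, 0, 1})"
      by (rule image_eqI)
  qed
  then have "finite C" using finD by (meson finite_PiE finite_imageI finite_subset finite.intros)
  have coord: "sgn (q $ i) = sgn (p $ i)" if "q \<in> cell p" for p q i
  proof -
    have "axis i 1 \<in> D" by (auto simp: D_def)
    then have "sgn (axis i 1 \<bullet> q) = sgn (axis i 1 \<bullet> p)" using that by (auto simp: cell_def)
    then show ?thesis by (simp add: inner_axis')
  qed
  have sub: "cell p \<subseteq> non_orthant" if p: "p \<in> non_orthant" for p
  proof
    fix q assume q: "q \<in> cell p"
    obtain i where "p $ i < 0" using p by (auto simp: non_orthant_def not_le)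
    then have "q $ i < 0" using coord[OF q, of i] by (metis sgn_less)
    then show "q \<in> non_orthant" by (auto simp: non_orthant_def not_le)
  qed
  have self: "p \<in> cell p" for p by (simp add: cell_def)
  have eqc: "cell p = cell q" if "r \<in> cell p" "r \<in> cell q" for p q r
    using that by (auto simp: cell_def)
  have "partition_on non_orthant C"
  proof (rule partition_onI)
    show "\<Union>C = non_orthant" using sub self by (auto simp: C_def)
    show "{} \<notin> C" using self by (auto simp: C_def)
    show "\<And>\<sigma> \<tau>. \<sigma> \<in> C \<Longrightarrow> \<tau> \<in> C \<Longrightarrow> \<sigma> \<noteq> \<tau> \<Longrightarrow> disjnt \<sigma> \<tau>"
      unfolding C_def disjnt_def using eqc by blast
  qed
  moreover have "convex_polyhedral_cone \<sigma>" if \<sigma>: "\<sigma> \<in> C" for \<sigma>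
  proof -
    obtain p where p: "\<sigma> = cell p" using \<sigma> by (auto simp: C_def)
    define A where "A = {d \<in> D. d \<bullet> p = 0} \<union> uminus ` {d \<in> D. d \<bullet> p = 0}"
    define B where "B = (\<lambda>d. sgn (d \<bullet> p) *\<^sub>R d) ` {d \<in> D. d \<bullet> p \<noteq> 0}"
    have AA: "(\<forall>a\<in>A. 0 \<le> a \<bullet> q) \<longleftrightarrow> (\<forall>d\<in>D. d \<bullet> p = 0 \<longrightarrow> d \<bullet> q = 0)" for q
      unfolding A_def by (auto simp: ball_Un inner_minus_left intro: order.antisym)
    have BB: "(\<forall>b\<in>B. 0 < b \<bullet> q) \<longleftrightarrow> (\<forall>d\<in>D. d \<bullet> p \<noteq> 0 \<longrightarrow> 0 < sgn (d \<bullet> p) * (d \<bullet> q))" for q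
      by (auto simp: B_def)
    have key: "sgn y = sgn x \<longleftrightarrow> (x = 0 \<longrightarrow> y = 0) \<and> (x \<noteq> 0 \<longrightarrow> 0 < sgn x * y)" for x y :: real
      by (auto simp: sgn_real_def)
    have "q \<in> cell p \<longleftrightarrow> (\<forall>a\<in>A. 0 \<le> a \<bullet> q) \<and> (\<forall>b\<in>B. 0 < b \<bullet> q)" for q
      unfolding AA BB cell_def mem_Collect_eq key by blast
    then have "\<sigma> = {q. (\<forall>a\<in>A. 0 \<le> a \<bullet> q) \<and> (\<forall>b\<in>B. 0 < b \<bullet> q)}"
      using p by blast
    moreover have "finite A" "finite B" using finD by (auto simp: A_def B_def)
    ultimately show ?thesis unfolding convex_polyhedral_cone_def by blast
  qed
  moreover have "\<exists>E \<in> non_orthant // same_faces F. \<sigma> \<subseteq> E" if \<sigma>: "\<sigma> \<in> C" for \<sigma>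
  proof -
    obtain p where p: "p \<in> non_orthant" "\<sigma> = cell p" using \<sigma> by (auto simp: C_def)
    have "(p, q) \<in> same_faces F" if q: "q \<in> cell p" for q
    proof -
      have sg: "sgn ((v - w) \<bullet> q) = sgn ((v - w) \<bullet> p)" if "v \<in> S (F j)" "w \<in> S (F j)" for v w j
      proof -
        have "v - w \<in> D" unfolding D_def using that by force
        then show ?thesis using q by (auto simp: cell_def)
      qed
      have "min_face p (F j) = min_face q (F j)" for j
      proof
        show "min_face p (F j) \<subseteq> min_face q (F j)"
          by (rule min_face_subset_of_sgn, rule sg[symmetric]) (simp_all add: S_def)
        show "min_face q (F j) \<subseteq> min_face p (F j)"
          by (rule min_face_subset_of_sgn, rule sg) (simp_all add: S_def)
      qed
      then show ?thesis using sub[OF p(1)] p(1) q by (auto simp: same_faces_def)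
    qed
    then have "\<sigma> \<subseteq> same_faces F `` {p}" using p(2) by auto
    then show ?thesis using p(1) by (auto intro: quotientI)
  qed
  ultimately have "cone_subdivision F C"
    using \<open>finite C\<close> by (simp add: cone_subdivision_def)
  then show ?thesis ..
qed

end

theory Submission
  imports Defs
begin

text \<open>
  If some coordinate \<open>p\<^sub>i\<close> is negative, convenience puts a point of negative \<open>l\<^sub>p\<close>-value on the
  \<open>i\<close>-th axis of every Newton polyhedron, so no face \<open>\<Delta>\<^sub>p\<^sup>j\<close> contains the origin: for
  every cone \<open>\<sigma>\<close>, \<open>I\<^sub>\<sigma>\<close> is the full index set and \<open>J\<^sub>\<sigma>\<close> is empty. A cone need not contain an
  integer vector, but simultaneous Dirichlet approximation of a real \<open>p\<close> yields an integer vector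
  with the same faces. Hence (BA) says that all \<open>G\<^sub>\<sigma>\<close> are empty, which implies (ND). Conversely,
  \<open>f\<^sub>\<Delta>\<close> is quasi-homogeneous with weights \<open>p\<close>, so at a common zero \<open>x\<close> in the torus Euler's
  formula puts the nonzero vector \<open>(p\<^sub>i x\<^sub>i)\<^sub>i\<close> into the kernel of the differential. If \<open>k = n\<close>, the
  differential is then not surjective, which contradicts (ND).
\<close>

section \<open>Integer vectors with the same faces as a real vector\<close>

lemma real_vec_eq_int_vec: "real_vec \<nu> = int_vec (\<chi> i. int (\<nu> $ i))"
  by (simp add: real_vec_def int_vec_def vec_eq_iff)

lemma int_vec_diff: "int_vec (a - b) = int_vec a - int_vec b"
  by (simp add: int_vec_def vec_eq_iff)

lemma int_vec_0 [simp]: "int_vec 0 = 0"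
  by (simp add: int_vec_def vec_eq_iff)

lemma inner_int_vec: "int_vec a \<bullet> int_vec b = of_int (\<Sum>i\<in>UNIV. a $ i * b $ i)"
  by (simp add: int_vec_def inner_vec_def)

lemma Dirichlet_approx_vec:
  fixes p :: "real ^ 'n::finite" and N :: nat
  assumes "N > 0"
  obtains m :: int and q :: "int ^ 'n"
    where "m > 0" "\<And>i. \<bar>of_int m * p $ i - of_int (q $ i)\<bar> < 1 / N"
proof -
  obtain h :: "nat \<Rightarrow> 'n" where h: "bij_betw h {0..<CARD('n)} UNIV"
    using ex_bij_betw_nat_finite finite by blast
  obtain m r where m: "m > 0"
    and r: "\<And>j. j < CARD('n) \<Longrightarrow> \<bar>of_int m * p $ h j - of_int (r j)\<bar> < 1 / N"
    using Dirichlet_approx_simult[OF assms, of "CARD('n)" "\<lambda>j. p $ h j"] by metis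
  define g where "g = inv_into {0..<CARD('n)} h"
  have "g i < CARD('n) \<and> h (g i) = i" for i
    using h unfolding g_def bij_betw_def
    by (metis UNIV_I atLeastLessThan_iff f_inv_into_f inv_into_into)
  then have "\<bar>of_int m * p $ i - of_int ((\<chi> i. r (g i)) $ i)\<bar> < 1 / N" for i
    using r[of "g i"] by simp
  with m that show thesis by blast
qed

text \<open>Scaling by \<open>m > 0\<close> keeps all signs, so it suffices that \<open>q\<close> be
  close enough to \<open>m p\<close>. Nonzero products then keep their sign; a product that vanishes
  at \<open>p\<close> becomes an integer of absolute value below 1, hence 0.\<close>

lemma ex_int_vec_sgn_eq:
  fixes p :: "real ^ 'n::finite" and D :: "(int ^ 'n) set"
  assumes "finite D"
  shows "\<exists>q. \<forall>d\<in>D. sgn (int_vec d \<bullet> int_vec q) = sgn (int_vec d \<bullet> p)"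
proof -
  define B :: "int ^ 'n \<Rightarrow> real" where "B d = (\<Sum>i\<in>UNIV. \<bar>of_int (d $ i)\<bar>)" for d
  \<comment> \<open>\<open>N > bound d\<close> gives both \<open>B d / N < 1\<close> and, when the
    product with \<open>p\<close> is nonzero, \<open>B d / N\<close> below its absolute value. If
    the product is 0, the second entry is 0 because division by zero gives 0.\<close>
  define bound where "bound d = max (B d) (B d / \<bar>int_vec d \<bullet> p\<bar>)" for d
  have "\<forall>\<^sub>F N :: nat in sequentially. \<forall>d\<in>D. bound d < real N"
    using assms by (intro eventually_ball_finite ballI)
      (use filterlim_real_sequentially in \<open>auto simp: filterlim_at_top_dense\<close>)
  then have "\<forall>\<^sub>F N :: nat in sequentially. (\<forall>d\<in>D. bound d < real N) \<and> 0 < N"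
    using eventually_gt_at_top by (rule eventually_conj)
  then obtain N :: nat where N: "0 < N" "\<And>d. d \<in> D \<Longrightarrow> bound d < real N"
    using eventually_happens'[OF sequentially_bot] by blast
  obtain m :: int and q :: "int ^ 'n" where m: "m > 0"
    and q: "\<And>i. \<bar>of_int m * p $ i - of_int (q $ i)\<bar> < 1 / N"
    using Dirichlet_approx_vec[OF N(1)] by metis
  have "sgn (int_vec d \<bullet> int_vec q) = sgn (int_vec d \<bullet> p)" if d: "d \<in> D" for d
  proof -
    define e where "e = of_int m * (int_vec d \<bullet> p) - int_vec d \<bullet> int_vec q"
    have "e = (\<Sum>i\<in>UNIV. of_int (d $ i) * (of_int m * p $ i - of_int (q $ i)))"
      by (simp add: e_def int_vec_def inner_vec_def sum_distrib_left sum_subtractf algebra_simps)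
    also have "\<bar>\<dots>\<bar> \<le> (\<Sum>i\<in>UNIV. \<bar>of_int (d $ i)\<bar> * (1 / N))"
      by (intro order.trans[OF sum_abs] sum_mono)
        (simp add: abs_mult mult_left_mono less_imp_le[OF q] del: times_divide_eq_right)
    also have "\<dots> = B d / N"
      by (simp add: B_def sum_divide_distrib)
    finally have e: "\<bar>e\<bar> \<le> B d / N" .
    show ?thesis
    proof (cases "int_vec d \<bullet> p = 0")
      case True
      have "B d / N < 1"
        using N(1) N(2)[OF d] by (simp add: bound_def)
      then have "\<bar>int_vec d \<bullet> int_vec q\<bar> < 1"
        using e True by (simp add: e_def)
      then have "int_vec d \<bullet> int_vec q = 0"
        unfolding inner_int_vec by (simp flip: of_int_abs del: of_int_sum of_int_mult)
      then show ?thesis using True by simp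
    next
      case False
      have "B d / N < \<bar>int_vec d \<bullet> p\<bar>"
        using N(1) N(2)[OF d] False by (simp add: bound_def field_simps)
      also have "\<dots> \<le> of_int m * \<bar>int_vec d \<bullet> p\<bar>"
        using m mult_right_mono[of 1 "real_of_int m" "\<bar>int_vec d \<bullet> p\<bar>"] by simp
      also have "\<dots> = \<bar>of_int m * (int_vec d \<bullet> p)\<bar>"
        using m by (simp add: abs_mult)
      finally have "\<bar>e\<bar> < \<bar>of_int m * (int_vec d \<bullet> p)\<bar>" using e by linarith
      \<comment> \<open>The error \<open>e\<close> is smaller than the number it perturbs, so it
        cannot change the sign.\<close>
      then have "sgn (int_vec d \<bullet> int_vec q) = sgn (of_int m * (int_vec d \<bullet> p))"
        unfolding e_def by (auto simp: sgn_real_def)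
      then show ?thesis using m by (simp add: sgn_mult)
    qed
  qed
  then show ?thesis by blast
qed

lemma non_orthant_iff: "p \<in> non_orthant \<longleftrightarrow> (\<exists>i. p $ i < 0)"
  by (auto simp: non_orthant_def not_le)

lemma Min_neg_iff_non_orthant:
  fixes p :: "int ^ 'n::finite"
  shows "Min (range (\<lambda>i. p $ i)) < 0 \<longleftrightarrow> int_vec p \<in> non_orthant"
  by (simp add: Min_less_iff non_orthant_iff int_vec_def)

text \<open>Faces depend only on the signs of the linear form on differences of points of the
  supports and 0. These differences are integral and finite in number.\<close>

lemma ex_int_vec_min_face_eq:
  fixes F :: "'k::finite \<Rightarrow> 'n::finite rpoly"
  assumes "p \<in> non_orthant"
  shows "\<exists>q. int_vec q \<in> non_orthant \<and> (\<forall>j. min_face (int_vec q) (F j) = min_face p (F j))"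
proof -
  define T where "T f = insert 0 ((\<lambda>\<nu>. \<chi> i. int (\<nu> $ i)) ` Poly_Mapping.keys f)" for f :: "'n rpoly"
  \<comment> \<open>The axis vectors are included so that \<open>q\<close> inherits a negative
    coordinate from \<open>p\<close>.\<close>
  define D where "D = (\<Union>j. (\<lambda>(v, w). v - w) ` (T (F j) \<times> T (F j))) \<union> range (\<lambda>i. axis i 1)"
  have "finite D" by (auto simp: D_def T_def)
  then obtain q where q: "\<And>d. d \<in> D \<Longrightarrow> sgn (int_vec d \<bullet> int_vec q) = sgn (int_vec d \<bullet> p)"
    using ex_int_vec_sgn_eq by metis
  have T: "insert 0 (real_vec ` Poly_Mapping.keys f) = int_vec ` T f" for f :: "'n rpoly"
    by (simp add: T_def image_image real_vec_eq_int_vec)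
  have sg: "sgn ((v - w) \<bullet> int_vec q) = sgn ((v - w) \<bullet> p)"
    if "v \<in> insert 0 (real_vec ` Poly_Mapping.keys (F j))"
      "w \<in> insert 0 (real_vec ` Poly_Mapping.keys (F j))" for v w j
  proof -
    obtain a b where ab: "a \<in> T (F j)" "b \<in> T (F j)" "v = int_vec a" "w = int_vec b"
      using \<open>v \<in> _\<close> \<open>w \<in> _\<close> unfolding T by blast
    then have "a - b \<in> D" unfolding D_def by force
    from q[OF this] show ?thesis using ab by (simp add: int_vec_diff)
  qed
  have "min_face (int_vec q) (F j) = min_face p (F j)" for j
    by (intro equalityI min_face_subset_of_sgn sg sg[symmetric])
  moreover obtain i where i: "p $ i < 0" using assms by (auto simp: non_orthant_iff)
  have "int_vec (axis i 1) = axis i 1"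
    by (simp add: int_vec_def axis_def vec_eq_iff)
  then have "sgn (int_vec q $ i) = sgn (p $ i)"
    using q[of "axis i 1"] by (simp add: D_def inner_axis')
  then have "int_vec q \<in> non_orthant"
    using i unfolding non_orthant_iff by (metis sgn_less)
  ultimately show ?thesis by blast
qed

section \<open>Faces avoid the origin; (BA) implies (ND)\<close>

lemma poly_eval_0: "poly_eval f 0 = Poly_Mapping.lookup f 0"
proof -
  \<comment> \<open>Since \<open>0 ^ 0 = 1\<close>, exactly the constant monomial survives at the
    origin.\<close>
  have prod_0: "(\<Prod>i\<in>UNIV. (0 :: real) ^ (\<nu> $ i)) = (if \<nu> = 0 then 1 else 0)" for \<nu> :: "nat ^ 'a"
    by (auto simp: vec_eq_iff power_0_left)
  show ?thesis
    unfolding poly_eval_def by (simp only: zero_index prod_0) (simp add: in_keys_iff if_distrib cong: if_cong)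
qed

lemma real_vec_in_newton_polyhedron:
  "\<nu> \<in> Poly_Mapping.keys f \<Longrightarrow> real_vec \<nu> \<in> newton_polyhedron f"
  by (auto simp: newton_polyhedron_def intro: hull_inc)

lemma zero_notin_min_face:
  assumes "convenient f" "poly_eval f 0 = 0" "p \<in> non_orthant"
  shows "0 \<notin> min_face p f"
proof
  assume 0: "0 \<in> min_face p f"
  obtain i where i: "p $ i < 0" using assms(3) by (auto simp: non_orthant_iff)
  obtain m where m: "axis i m \<in> Poly_Mapping.keys f"
    using assms(1) by (auto simp: convenient_def)
  \<comment> \<open>\<open>convenient\<close> by itself allows \<open>m = 0\<close>, where
    \<open>axis i m\<close> is the origin; the vanishing constant term excludes this.\<close>
  have "0 \<notin> Poly_Mapping.keys f" using assms(2) by (simp add: poly_eval_0 in_keys_iff)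
  then have "m \<noteq> 0" using m by (metis axis_eq_0_iff)
  have "real_vec (axis i m) = axis i (real m)"
    by (simp add: real_vec_def axis_def vec_eq_iff)
  then have "0 \<le> p $ i * real m"
    using 0 real_vec_in_newton_polyhedron[OF m] by (auto simp: min_face_def inner_axis)
  then show False using i \<open>m \<noteq> 0\<close> by (simp add: zero_le_mult_iff)
qed

lemma cone_subdivision_subset_non_orthant:
  "cone_subdivision F C \<Longrightarrow> \<sigma> \<in> C \<Longrightarrow> \<sigma> \<subseteq> non_orthant"
  by (auto simp: cone_subdivision_def partition_on_def)

lemma I_set_eq_UNIV:
  assumes "\<forall>j. poly_eval (F j) 0 = 0" "\<forall>j. convenient (F j)"
    and "cone_subdivision F C" "\<sigma> \<in> C" "p \<in> \<sigma>"
  shows "I_set F \<sigma> = UNIV"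
proof -
  have "p \<in> non_orthant" using assms(3-5) cone_subdivision_subset_non_orthant by blast
  then show ?thesis
    using assms(1,2) zero_notin_min_face by (auto simp: I_set_def cone_face_eq[OF assms(3-5)])
qed

lemma J_set_subset: "J_set F \<sigma> \<subseteq> - I_set F \<sigma>"
  by (auto simp: I_set_def J_set_def)

lemma BA_imp_ND:
  assumes "\<forall>j. poly_eval (F j) 0 = 0" "\<forall>j. convenient (F j)" "cone_subdivision F C" "BA F"
  shows "ND F C"
proof -
  have "G_set F \<sigma> = {}" if \<sigma>: "\<sigma> \<in> C" for \<sigma>
  proof -
    obtain p where p: "p \<in> \<sigma>"
      using assms(3) \<sigma> unfolding cone_subdivision_def partition_on_def by fastforce
    \<comment> \<open>\<open>int_vec q\<close> may lie outside \<sigma>; only its faces matter, and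
      with a full index set they turn the empty set in (BA) into
      \<open>G_set F \<sigma>\<close>.\<close>
    then obtain q where q: "int_vec q \<in> non_orthant"
      "\<And>j. min_face (int_vec q) (F j) = cone_face \<sigma> (F j)"
      using ex_int_vec_min_face_eq[of p F] cone_face_eq[OF assms(3) \<sigma> p]
        cone_subdivision_subset_non_orthant[OF assms(3) \<sigma>] by auto
    have "I_set F \<sigma> = UNIV" by (rule I_set_eq_UNIV[OF assms(1-3) \<sigma> p])
    moreover have "{x \<in> torus. \<forall>j. poly_eval (face_part (cone_face \<sigma> (F j)) (F j)) x = 0} = {}"
      using assms(4)[unfolded BA_def Min_neg_iff_non_orthant, rule_format, OF q(1)]
      by (simp add: q(2))
    ultimately show ?thesis by (simp add: G_set_def)
  qed
  then show ?thesis by (simp add: ND_def)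
qed

section \<open>Quasi-homogeneity and Euler's formula\<close>

lemma keys_face_part:
  "Poly_Mapping.keys (face_part \<Delta> f) = {\<nu> \<in> Poly_Mapping.keys f. real_vec \<nu> \<in> \<Delta>}"
proof -
  have "Poly_Mapping.lookup (face_part \<Delta> f) \<nu> =
      (if \<nu> \<in> Poly_Mapping.keys f \<and> real_vec \<nu> \<in> \<Delta> then Poly_Mapping.lookup f \<nu> else 0)" for \<nu>
    by (simp add: face_part_def lookup_sum lookup_single when_def)
  then show ?thesis by (auto simp: in_keys_iff split: if_splits)
qed

text \<open>All points of a minimal face share the minimum of the linear form, which is the weighted
  degree \<open>d\<close>.\<close>

lemma face_part_min_face_quasihomogeneous:
  "\<exists>d. \<forall>\<nu>\<in>Poly_Mapping.keys (face_part (min_face p f) f). p \<bullet> real_vec \<nu> = d"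
proof -
  have "p \<bullet> v = p \<bullet> w" if "v \<in> min_face p f" "w \<in> min_face p f" for v w
    using that by (auto simp: min_face_def intro: order.antisym)
  then show ?thesis
    unfolding keys_face_part by (metis (no_types, lifting) mem_Collect_eq)
qed

lemma has_derivative_poly_eval:
  "(poly_eval f has_derivative (\<lambda>h. \<Sum>\<nu>\<in>Poly_Mapping.keys f. Poly_Mapping.lookup f \<nu> *
     (\<Sum>i\<in>UNIV. real (\<nu> $ i) * h $ i * x $ i ^ (\<nu> $ i - 1) * (\<Prod>j\<in>UNIV - {i}. x $ j ^ (\<nu> $ j)))))
   (at x)"
  unfolding poly_eval_def[abs_def]
  by (rule has_derivative_sum, rule has_derivative_mult_right, rule has_derivative_prod,
      rule has_derivative_power, rule bounded_linear_imp_has_derivative, rule bounded_linear_vec_nth)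

text \<open>Differentiation along \<open>p $ i * x $ i\<close> multiplies each monomial by its
  weighted degree, which is \<open>d\<close> throughout.\<close>

lemma frechet_derivative_poly_eval_Euler:
  assumes "\<forall>\<nu>\<in>Poly_Mapping.keys f. p \<bullet> real_vec \<nu> = d"
  shows "frechet_derivative (poly_eval f) (at x) (\<chi> i. p $ i * x $ i) = d * poly_eval f x"
proof -
  \<comment> \<open>If the exponent is 0, the truncated \<open>\<nu> $ i - 1\<close> does no harm:
    the factor \<open>real (\<nu> $ i)\<close> makes both sides 0.\<close>
  have mono: "real (\<nu> $ i) * (p $ i * x $ i) * x $ i ^ (\<nu> $ i - 1) * (\<Prod>j\<in>UNIV - {i}. x $ j ^ (\<nu> $ j))
      = p $ i * real (\<nu> $ i) * (\<Prod>j\<in>UNIV. x $ j ^ (\<nu> $ j))" for \<nu> :: "nat ^ 'a" and i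
  proof (cases "\<nu> $ i")
    case (Suc m)
    then show ?thesis
      by (simp add: prod.remove[of UNIV i "\<lambda>j. x $ j ^ (\<nu> $ j)"] ac_simps)
  qed simp
  have "frechet_derivative (poly_eval f) (at x) (\<chi> i. p $ i * x $ i) =
      (\<Sum>\<nu>\<in>Poly_Mapping.keys f. Poly_Mapping.lookup f \<nu> *
        ((p \<bullet> real_vec \<nu>) * (\<Prod>j\<in>UNIV. x $ j ^ (\<nu> $ j))))"
    unfolding frechet_derivative_at[OF has_derivative_poly_eval, symmetric]
    by (simp only: vec_lambda_beta mono)
      (simp add: inner_vec_def real_vec_def sum_distrib_right)
  also have "\<dots> = d * poly_eval f x"
    using assms by (simp add: poly_eval_def sum_distrib_left ac_simps)
  finally show ?thesis .
qed

section \<open>Kernels and singular points; (ND) implies (BA)\<close>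

lemma frechet_derivative_subfamily_map:
  assumes "\<And>j. g j differentiable (at x)"
  shows "frechet_derivative (subfamily_map UNIV g) (at x) = (\<lambda>h. \<chi> j. frechet_derivative (g j) (at x) h)"
    and "subfamily_map UNIV g differentiable (at x)"
proof -
  have D: "(subfamily_map UNIV g has_derivative (\<lambda>h. \<chi> j. frechet_derivative (g j) (at x) h)) (at x)"
    unfolding has_derivative_componentwise_within[of "subfamily_map UNIV g"]
    using assms by (auto simp: Basis_vec_def inner_axis subfamily_map_def frechet_derivative_works)
  show "frechet_derivative (subfamily_map UNIV g) (at x) = (\<lambda>h. \<chi> j. frechet_derivative (g j) (at x) h)"
    by (rule frechet_derivative_at[OF D, symmetric])
  show "subfamily_map UNIV g differentiable (at x)"
    by (rule differentiableI[OF D])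
qed

text \<open>Between spaces of equal dimension a surjective linear map is injective, so a nonzero
  kernel vector rules out surjectivity. For the full index set, the target subspace in
  \<open>Sing\<close> is the whole space.\<close>

lemma in_Sing_of_kernel:
  fixes g :: "'k::finite \<Rightarrow> real ^ 'n::finite \<Rightarrow> real"
  assumes "CARD('k) = CARD('n)" "\<And>j. g j differentiable (at x)"
    and "v \<noteq> 0" "\<And>j. frechet_derivative (g j) (at x) v = 0"
  shows "x \<in> Sing UNIV g"
proof -
  let ?L = "frechet_derivative (subfamily_map UNIV g) (at x)"
  have lin: "linear ?L"
    by (rule linear_frechet_derivative[OF frechet_derivative_subfamily_map(2)[OF assms(2)]])
  have "?L v = 0"
    using assms(4) by (simp add: frechet_derivative_subfamily_map(1)[OF assms(2)] vec_eq_iff)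
  then have "\<not> inj ?L"
    using assms(3) lin by (metis injD linear_0)
  then have "\<not> surj ?L"
    using linear_surjective_imp_injective[OF lin] assms(1) by (auto simp: dim_UNIV)
  then show ?thesis by (simp add: Sing_def)
qed

lemma ND_imp_BA:
  fixes F :: "'k::finite \<Rightarrow> 'n::finite rpoly"
  assumes "\<forall>j. poly_eval (F j) 0 = 0" "\<forall>j. convenient (F j)" "cone_subdivision F C" "ND F C"
    and card: "CARD('k) = CARD('n)"
  shows "BA F"
  unfolding BA_def Min_neg_iff_non_orthant
proof (intro allI impI, rule ccontr)
  fix p' :: "int ^ 'n"
  define p where "p = int_vec p'"
  define g where "g j = face_part (min_face p (F j)) (F j)" for j
  assume "int_vec p' \<in> non_orthant"
    and "{x \<in> torus. \<forall>j. poly_eval (face_part (min_face (int_vec p') (F j)) (F j)) x = 0} \<noteq> {}"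
  then obtain x where p: "p \<in> non_orthant" and x: "x \<in> torus" "\<And>j. poly_eval (g j) x = 0"
    by (auto simp: p_def g_def)
  obtain \<sigma> where \<sigma>: "\<sigma> \<in> C" "p \<in> \<sigma>"
    using p assms(3) unfolding cone_subdivision_def partition_on_def by blast
  note face = cone_face_eq[OF assms(3) \<sigma>]
  have I: "I_set F \<sigma> = UNIV" by (rule I_set_eq_UNIV[OF assms(1-3) \<sigma>])
  then have "J_set F \<sigma> = {}" using J_set_subset[of F \<sigma>] by simp
  then have "Sing UNIV (\<lambda>j. poly_eval (g j)) \<inter> G_set F \<sigma> = {}"
    using assms(4)[unfolded ND_def, THEN bspec, OF \<sigma>(1)] I by (simp add: face g_def)
  moreover have "x \<in> G_set F \<sigma>"
    using x by (simp add: G_set_def face g_def)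
  moreover have "x \<in> Sing UNIV (\<lambda>j. poly_eval (g j))"
  proof (rule in_Sing_of_kernel[OF card])
    show "poly_eval (g j) differentiable (at x)" for j
      using has_derivative_poly_eval by (rule differentiableI)
    \<comment> \<open>Some \<open>p $ i\<close> is negative, and \<open>x $ i\<close> is nonzero on
      the torus.\<close>
    show "(\<chi> i. p $ i * x $ i) \<noteq> 0"
      using p x(1) by (force simp: vec_eq_iff non_orthant_iff torus_def)
    show "frechet_derivative (poly_eval (g j)) (at x) (\<chi> i. p $ i * x $ i) = 0" for j
    proof -
      obtain d where "\<forall>\<nu>\<in>Poly_Mapping.keys (g j). p \<bullet> real_vec \<nu> = d"
        using face_part_min_face_quasihomogeneous unfolding g_def by blast
      from frechet_derivative_poly_eval_Euler[OF this] show ?thesis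
        by (simp add: x(2))
    qed
  qed
  ultimately show False by blast
qed

theorem proposition5p2:
  fixes F :: "'k::finite \<Rightarrow> 'n::finite rpoly"
    and C :: "(real ^ 'n) set set"
  assumes "CARD('k) \<le> CARD('n)"
    and "\<forall>j. poly_eval (F j) 0 = 0"
    and "\<forall>j. convenient (F j)"
    and "cone_subdivision F C"
  shows "(BA F \<longrightarrow> ND F C) \<and> (CARD('k) = CARD('n) \<longrightarrow> (BA F \<longleftrightarrow> ND F C))"
  using BA_imp_ND[OF assms(2-4)] ND_imp_BA[OF assms(2-4)] by blast

end
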